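(* Let $-\infty<a<b<\infty$, let $\alpha>0$ be arbitrary and let $f\in C^{\lceil\alpha\rceil-1}[a,b]$ be continuously Caputo $\alpha$-differentiable. Then for any integer $l$ with $0\le l\le\lceil\alpha\rceil-1$ the function $f$ is continuously Caputo $l$-differentiable with $f_1:=D^{l}f\in C[a,b]$, and the derivative $f_1$ is continuously Caputo $(\alpha-l)$-differentiable. Moreover, ${}^{C}D_a^{\alpha-l}f_1={}^{C}D_a^{\alpha}f$; thus ${}^{C}D_a^{\alpha-l}D^{l}f={}^{C}D_a^{\alpha}f$.
   Context: Let $[a,b]\subset\mathbb{R}$, $-\infty<a<b<\infty$. For $\alpha>0$ the Riemann-Liouville fractional integral operator is $J_a^\alpha f(x):=\frac{1}{\Gamma(\alpha)}\int_a^x (x-t)^{\alpha-1}f(t)\,dt$ for $a\le x\le b$; $J_a^0$ is the identity. $D^m$ denotes the ordinary derivative of integer order $m$. For $\alpha>0$ and $m:=\lceil\alpha\rceil$ put ${}^{RL}D_a^{\alpha}f:=D^mJ_a^{m-\alpha}f$ (Riemann-Liouville derivative). For $\alpha>0$, $m:=\lceil\alpha\rceil$ and $f\in C^{m-1}[a,b]$, the Caputo fractional derivative of order $\alpha$ is ${}^{C}D_a^{\alpha}f:={}^{RL}D_a^{\alpha}(f-T_{m-1}[f;a])$, where $T_{m-1}[f;a](t):=\sum_{k=0}^{m-1}\frac{(D^kf)(a)}{k!}(t-a)^k$; ${}^{C}D_a^0$ is the identity. A function $f\in C^{m-1}[a,b]$ is called continuously Caputo $\alpha$-differentiable if ${}^{C}D_a^{\alpha}f$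 exists and belongs to $C[a,b]$ (for $\alpha=0$: if $f\in C[a,b]$). *)

theory Defs
  imports "HOL-Analysis.Analysis"
begin

text \<open>
  Functions on the interval from a to b are represented by total functions on the reals. All notions
  below depend only on the values on the interval, and are meant to be evaluated only there.
  Derivatives are relative to the interval, hence one-sided at the endpoints.
\<close>

definition nderiv :: "real \<Rightarrow> real \<Rightarrow> nat \<Rightarrow> (real \<Rightarrow> real) \<Rightarrow> real \<Rightarrow> real" where
  "nderiv a b n = (\<lambda>g x. vector_derivative g (at x within {a..b})) ^^ n"

definition ntimes_differentiable :: "real \<Rightarrow> real \<Rightarrow> nat \<Rightarrow> (real \<Rightarrow> real) \<Rightarrow> bool" where
  "ntimes_differentiable a b n f \<longleftrightarrow> (\<forall>k<n. nderiv a b k f differentiable_on {a..b})"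

definition Cn :: "real \<Rightarrow> real \<Rightarrow> nat \<Rightarrow> (real \<Rightarrow> real) \<Rightarrow> bool" where
  "Cn a b n f \<longleftrightarrow> ntimes_differentiable a b n f \<and> continuous_on {a..b} (nderiv a b n f)"

definition RL_integral :: "real \<Rightarrow> real \<Rightarrow> (real \<Rightarrow> real) \<Rightarrow> real \<Rightarrow> real" where
  "RL_integral a \<alpha> f x =
     (if \<alpha> = 0 then f x
      else 1 / Gamma \<alpha> * (LINT t:{a..x}|lborel. (x - t) powr (\<alpha> - 1) * f t))"

definition RL_deriv :: "real \<Rightarrow> real \<Rightarrow> real \<Rightarrow> (real \<Rightarrow> real) \<Rightarrow> real \<Rightarrow> real" where
  "RL_deriv a b \<alpha> f =
     (let m = nat \<lceil>\<alpha>\<rceil> in nderiv a b m (RL_integral a (real m - \<alpha>) f))"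

definition RL_deriv_exists :: "real \<Rightarrow> real \<Rightarrow> real \<Rightarrow> (real \<Rightarrow> real) \<Rightarrow> bool" where
  "RL_deriv_exists a b \<alpha> f \<longleftrightarrow>
     (let m = nat \<lceil>\<alpha>\<rceil> in ntimes_differentiable a b m (RL_integral a (real m - \<alpha>) f))"

definition taylor_poly :: "real \<Rightarrow> real \<Rightarrow> nat \<Rightarrow> (real \<Rightarrow> real) \<Rightarrow> real \<Rightarrow> real" where
  "taylor_poly a b n f t = (\<Sum>k=0..n. nderiv a b k f a / fact k * (t - a) ^ k)"

text \<open>
  For positive order the natural number \<open>nat \<lceil>\<alpha>\<rceil>\<close> is at least 1, so the subtractions of 1 below
  do not truncate.
\<close>

definition caputo_deriv :: "real \<Rightarrow> real \<Rightarrow> real \<Rightarrow> (real \<Rightarrow> real) \<Rightarrow> real \<Rightarrow> real" where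
  "caputo_deriv a b \<alpha> f =
     (if \<alpha> = 0 then f
      else RL_deriv a b \<alpha> (\<lambda>t. f t - taylor_poly a b (nat \<lceil>\<alpha>\<rceil> - 1) f t))"

definition caputo_deriv_exists :: "real \<Rightarrow> real \<Rightarrow> real \<Rightarrow> (real \<Rightarrow> real) \<Rightarrow> bool" where
  "caputo_deriv_exists a b \<alpha> f \<longleftrightarrow>
     \<alpha> = 0 \<or> RL_deriv_exists a b \<alpha> (\<lambda>t. f t - taylor_poly a b (nat \<lceil>\<alpha>\<rceil> - 1) f t)"

definition continuously_caputo_differentiable ::
    "real \<Rightarrow> real \<Rightarrow> real \<Rightarrow> (real \<Rightarrow> real) \<Rightarrow> bool" where
  "continuously_caputo_differentiable a b \<alpha> f \<longleftrightarrow>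
     (if \<alpha> = 0 then continuous_on {a..b} f
      else Cn a b (nat \<lceil>\<alpha>\<rceil> - 1) f \<and> caputo_deriv_exists a b \<alpha> f \<and>
           continuous_on {a..b} (caputo_deriv a b \<alpha> f))"

end

theory Submission
  imports Defs
begin

text \<open>
  Put \<open>\<beta> = m - \<alpha>\<close> and \<open>g = f - T\<^bsub>m-1\<^esub>[f;a]\<close>. Then \<open>D\<^sup>l g\<close> is \<open>D\<^sup>l f\<close> minus its own Taylor polynomial of
  degree \<open>m - l - 1\<close>, and both fractional derivatives are outer derivatives of fractional integrals
  of the same order \<open>\<beta>\<close>. So everything reduces to \<open>D\<^sup>l J\<^sup>\<beta> g = J\<^sup>\<beta> D\<^sup>l g\<close>. As the derivatives of \<open>g\<close> of order
  below \<open>l\<close> vanish at \<open>a\<close>, this follows by iterating \<open>D J\<^sup>\<beta> g = J\<^sup>\<beta> D g\<close> for \<open>C\<^sup>1\<close> functions with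
  \<open>g a = 0\<close>, which is differentiation under the integral sign in the convolution form of \<open>J\<^sup>\<beta>\<close>.
\<close>

section \<open>Iterated derivatives relative to the interval, and the classes
  \<open>Cn\<close>\<close>

lemma nderiv_0: "nderiv a b 0 f = f"
  by (simp add: nderiv_def)

lemma nderiv_Suc:
  "nderiv a b (Suc n) f x = vector_derivative (nderiv a b n f) (at x within {a..b})"
  by (simp add: nderiv_def)

lemma nderiv_add: "nderiv a b (m + n) f = nderiv a b m (nderiv a b n f)"
  by (simp add: nderiv_def funpow_add)

lemma nderiv_Suc_right: "nderiv a b (Suc n) f = nderiv a b n (nderiv a b 1 f)"
  using nderiv_add[of a b n 1 f] by simp

lemma vector_derivative_cong_on:
  assumes "\<And>x. x \<in> S \<Longrightarrow> f x = g x" "x \<in> S"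
  shows "vector_derivative f (at x within S) = vector_derivative g (at x within S)"
  by (rule vector_derivative_cong_eq) (use assms in auto)

lemma differentiable_on_cong:
  assumes "\<And>x. x \<in> S \<Longrightarrow> f x = g x"
  shows "f differentiable_on S \<longleftrightarrow> g differentiable_on S"
  unfolding differentiable_on_def
  by (intro ball_cong refl iffI; erule differentiable_transform_within[where d = 1])
     (use assms in auto)

text \<open>Derivatives are taken within the interval, so values outside never enter. Identities
  known only on the interval can therefore be differentiated repeatedly.\<close>

lemma nderiv_cong:
  assumes "\<And>x. x \<in> {a..b} \<Longrightarrow> f x = g x" "x \<in> {a..b}"
  shows "nderiv a b n f x = nderiv a b n g x"
  using assms(2)
proof (induction n arbitrary: x)
  case (Suc n)
  then show ?case
    unfolding nderiv_Suc by (intro vector_derivative_cong_on) auto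
qed (use assms in \<open>simp add: nderiv_0\<close>)

lemma ntimes_differentiable_cong:
  assumes "\<And>x. x \<in> {a..b} \<Longrightarrow> f x = g x"
  shows "ntimes_differentiable a b n f \<longleftrightarrow> ntimes_differentiable a b n g"
  unfolding ntimes_differentiable_def
  by (intro all_cong differentiable_on_cong nderiv_cong[OF assms])

lemma ntimes_differentiable_nderiv:
  "ntimes_differentiable a b (m + n) f \<Longrightarrow> ntimes_differentiable a b m (nderiv a b n f)"
  by (simp add: ntimes_differentiable_def flip: nderiv_add)

lemma Cn_nderiv: "Cn a b (m + n) f \<Longrightarrow> Cn a b m (nderiv a b n f)"
  by (auto simp: Cn_def nderiv_add intro: ntimes_differentiable_nderiv)

lemma Cn_mono:
  assumes "Cn a b n f" "k \<le> n"
  shows "Cn a b k f"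
proof (cases "k = n")
  case False
  with assms have "nderiv a b k f differentiable_on {a..b}"
    by (auto simp: Cn_def ntimes_differentiable_def)
  then show ?thesis
    using assms by (auto simp: Cn_def ntimes_differentiable_def differentiable_imp_continuous_on)
qed (use assms in simp)

lemma nderiv_has_field_derivative:
  assumes "nderiv a b k f differentiable_on {a..b}" "x \<in> {a..b}"
  shows "(nderiv a b k f has_field_derivative nderiv a b (Suc k) f x) (at x within {a..b})"
  using assms
  by (auto simp: differentiable_on_def nderiv_Suc has_real_derivative_iff_has_vector_derivative
      simp flip: vector_derivative_works)

text \<open>Since \<open>a < b\<close>, every point of the interval is a limit point of it. Hence
  derivatives within the interval are unique, also at the endpoints.\<close>

lemma nderiv_Suc_eqI:
  assumes "a < b" "x \<in> {a..b}" "(nderiv a b k f has_field_derivative D) (at x within {a..b})"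
  shows "nderiv a b (Suc k) f x = D"
  using assms
  by (auto simp: nderiv_Suc has_real_derivative_iff_has_vector_derivative
      intro!: vector_derivative_within_closed_interval)

section \<open>Taylor sums and the derivatives of Taylor remainders\<close>

text \<open>The sum stops below \<open>n\<close>, unlike in \<open>taylor_poly\<close>, so that differentiation lowers \<open>n\<close> by one all
  the way down to the empty sum.\<close>

definition taylor_sum :: "real \<Rightarrow> real \<Rightarrow> nat \<Rightarrow> (real \<Rightarrow> real) \<Rightarrow> real \<Rightarrow> real" where
  "taylor_sum a b n f t = (\<Sum>k<n. nderiv a b k f a / fact k * (t - a) ^ k)"

text \<open>Positivity rules out truncation: for \<open>n = 0\<close> the left side would still
  contain the constant term \<open>f a\<close>, while the right side is empty.\<close>

lemma taylor_poly_eq_taylor_sum: "0 < n \<Longrightarrow> taylor_poly a b (n - Suc 0) f t = taylor_sum a b n f t"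
  by (cases n) (simp_all add: taylor_poly_def taylor_sum_def atLeast0AtMost lessThan_Suc_atMost)

lemma taylor_sum_0: "taylor_sum a b 0 f t = 0"
  by (simp add: taylor_sum_def)

lemma taylor_sum_at_base: "0 < n \<Longrightarrow> taylor_sum a b n f a = f a"
  by (cases n) (simp_all add: taylor_sum_def sum.lessThan_Suc_shift nderiv_0 del: sum.lessThan_Suc)

text \<open>The constant term drops out, and the factor \<open>Suc k\<close> from the power turns
  \<open>fact (Suc k)\<close> into \<open>fact k\<close>. For \<open>n = 0\<close> both sums are
  empty, so the truncated \<open>n - 1\<close> does no harm.\<close>

lemma taylor_sum_has_field_derivative:
  "(taylor_sum a b n f has_field_derivative taylor_sum a b (n - 1) (nderiv a b 1 f) t) (at t within S)"
proof (cases n)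
  case (Suc n')
  have "((\<lambda>t. \<Sum>k<n'. nderiv a b (Suc k) f a / fact (Suc k) * (t - a) ^ Suc k) has_field_derivative
        (\<Sum>k<n'. nderiv a b (Suc k) f a / fact (Suc k) * (real (Suc k) * (t - a) ^ k))) (at t within S)"
  proof (intro DERIV_sum DERIV_cmult)
    show "((\<lambda>t. (t - a) ^ Suc k) has_field_derivative real (Suc k) * (t - a) ^ k) (at t within S)" for k
      by (rule derivative_eq_intros refl)+ simp
  qed
  moreover have "nderiv a b (Suc k) f a / fact (Suc k) * (real (Suc k) * (t - a) ^ k)
      = nderiv a b k (nderiv a b 1 f) a / fact k * (t - a) ^ k" for k
    unfolding nderiv_Suc_right by (simp add: divide_simps del: of_nat_Suc)
  ultimately have "((\<lambda>t. nderiv a b 0 f a / fact 0 * (t - a) ^ 0 +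
        (\<Sum>k<n'. nderiv a b (Suc k) f a / fact (Suc k) * (t - a) ^ Suc k)) has_field_derivative
        0 + taylor_sum a b n' (nderiv a b 1 f) t) (at t within S)"
    unfolding taylor_sum_def by (intro DERIV_add) (simp_all del: fact_Suc)
  then show ?thesis
    unfolding Suc taylor_sum_def sum.lessThan_Suc_shift by simp
qed (simp add: taylor_sum_def[abs_def])

text \<open>Each differentiation shifts the function to its derivative and removes one Taylor term.
  The case \<open>k < n\<close> at \<open>x = a\<close> gives the zeros of the remainder; for
  \<open>k = n\<close> the sum is empty and the plain derivative is left.\<close>

lemma nderiv_minus_taylor_sum:
  assumes "a < b" "ntimes_differentiable a b k f" "k \<le> n" "x \<in> {a..b}"
  shows "nderiv a b k (\<lambda>t. f t - taylor_sum a b n f t) x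
       = nderiv a b k f x - taylor_sum a b (n - k) (nderiv a b k f) x"
  using assms(2-4)
proof (induction k arbitrary: x)
  case (Suc k)
  let ?h = "\<lambda>t. f t - taylor_sum a b n f t"
  have IH: "nderiv a b k ?h y = nderiv a b k f y - taylor_sum a b (n - k) (nderiv a b k f) y"
    if "y \<in> {a..b}" for y
    using Suc that by (auto simp: ntimes_differentiable_def)
  have *: "nderiv a b (Suc 0) (nderiv a b k f) = nderiv a b (Suc k) f"
    by (simp flip: nderiv_add)
  have "((\<lambda>y. nderiv a b k f y - taylor_sum a b (n - k) (nderiv a b k f) y) has_field_derivative
      nderiv a b (Suc k) f x - taylor_sum a b (n - Suc k) (nderiv a b (Suc k) f) x) (at x within {a..b})"
    using taylor_sum_has_field_derivative[of a b "n - k" "nderiv a b k f" x "{a..b}"] Suc.prems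
    by (intro DERIV_diff nderiv_has_field_derivative) (auto simp: ntimes_differentiable_def *)
  then have "(nderiv a b k ?h has_field_derivative
      nderiv a b (Suc k) f x - taylor_sum a b (n - Suc k) (nderiv a b (Suc k) f) x) (at x within {a..b})"
    using IH Suc.prems
    by (auto simp: has_real_derivative_iff_has_vector_derivative intro: has_vector_derivative_transform)
  then show ?case
    using nderiv_Suc_eqI assms(1) Suc.prems(3) by blast
qed (simp add: nderiv_0)

lemma ntimes_differentiable_minus_taylor_sum:
  assumes "a < b" "ntimes_differentiable a b k f" "k \<le> n"
  shows "ntimes_differentiable a b k (\<lambda>t. f t - taylor_sum a b n f t)"
  unfolding ntimes_differentiable_def
proof (intro allI impI)
  fix i assume "i < k"
  have "taylor_sum a b (n - i) (nderiv a b i f) differentiable_on {a..b}"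
    using taylor_sum_has_field_derivative
    by (fastforce simp: differentiable_on_def real_differentiable_def)
  then have "(\<lambda>x. nderiv a b i f x - taylor_sum a b (n - i) (nderiv a b i f) x) differentiable_on {a..b}"
    using assms \<open>i < k\<close> by (intro differentiable_on_diff) (auto simp: ntimes_differentiable_def)
  moreover have "nderiv a b i (\<lambda>t. f t - taylor_sum a b n f t) x
       = nderiv a b i f x - taylor_sum a b (n - i) (nderiv a b i f) x" if "x \<in> {a..b}" for x
    using assms \<open>i < k\<close> that
    by (intro nderiv_minus_taylor_sum) (auto simp: ntimes_differentiable_def)
  ultimately show "nderiv a b i (\<lambda>t. f t - taylor_sum a b n f t) differentiable_on {a..b}"
    by (subst differentiable_on_cong)
qed

lemma Cn_minus_taylor_sum:
  assumes "a < b" "Cn a b k f" "k \<le> n"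
  shows "Cn a b k (\<lambda>t. f t - taylor_sum a b n f t)"
proof -
  have "continuous_on {a..b} (\<lambda>x. nderiv a b k f x - taylor_sum a b (n - k) (nderiv a b k f) x)"
    using assms
    by (intro continuous_on_diff DERIV_continuous_on[OF taylor_sum_has_field_derivative])
       (auto simp: Cn_def)
  then have "continuous_on {a..b} (nderiv a b k (\<lambda>t. f t - taylor_sum a b n f t))"
    using assms nderiv_minus_taylor_sum[OF assms(1) _ assms(3), of f]
    by (subst continuous_on_cong[OF refl]) (auto simp: Cn_def)
  then show ?thesis
    using ntimes_differentiable_minus_taylor_sum assms by (auto simp: Cn_def)
qed

section \<open>Fractional integrals as convolutions with a truncated power kernel\<close>

lemma RL_integral_cong:
  assumes "\<And>x. x \<in> {a..b} \<Longrightarrow> f x = g x" "x \<in> {a..b}"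
  shows "RL_integral a \<beta> f x = RL_integral a \<beta> g x"
proof -
  have "(LINT t:{a..x}|lborel. (x - t) powr (\<beta> - 1) * f t)
      = (LINT t:{a..x}|lborel. (x - t) powr (\<beta> - 1) * g t)"
    by (rule set_lebesgue_integral_cong) (use assms in auto)
  then show ?thesis
    using assms by (simp add: RL_integral_def)
qed

definition zero_ext :: "real \<Rightarrow> real \<Rightarrow> (real \<Rightarrow> real) \<Rightarrow> real \<Rightarrow> real" where
  "zero_ext a b g t = indicator {a..b} t *\<^sub>R g t"

text \<open>The cut at \<open>c\<close> secures integrability at infinity. With
  \<open>c = b - a\<close> nothing is lost, because \<open>s = x - t\<close> stays in
  \<open>{0..b - a}\<close> for \<open>a \<le> t \<le> x \<le> b\<close>.\<close>

definition RL_kernel :: "real \<Rightarrow> real \<Rightarrow> real \<Rightarrow> real" where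
  "RL_kernel c \<beta> s = indicator {0..c} s *\<^sub>R s powr (\<beta> - 1)"

text \<open>Substituting \<open>s = x - t\<close> and extending by zero makes the singular factor and the domain
  independent of \<open>x\<close>.\<close>

lemma RL_integral_convolution:
  assumes "\<beta> \<noteq> 0" "x \<in> {a..b}"
  shows "RL_integral a \<beta> g x
       = 1 / Gamma \<beta> * (LINT s|lborel. RL_kernel (b - a) \<beta> s * zero_ext a b g (x - s))"
proof -
  have "(LINT t:{a..x}|lborel. (x - t) powr (\<beta> - 1) * g t)
      = (LINT s|lborel. indicator {a..x} (x - s) *\<^sub>R (s powr (\<beta> - 1) * g (x - s)))"
    unfolding set_lebesgue_integral_def
    by (subst lborel_integral_real_affine[where c = "-1" and t = x]) simp_all
  also have "\<dots> = (LINT s|lborel. RL_kernel (b - a) \<beta> s * zero_ext a b g (x - s))"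
    by (rule Bochner_Integration.integral_cong)
       (use assms in \<open>auto simp: RL_kernel_def zero_ext_def indicator_def\<close>)
  finally show ?thesis
    using assms by (simp add: RL_integral_def)
qed

lemma RL_kernel_nonneg: "0 \<le> RL_kernel c \<beta> s"
  by (simp add: RL_kernel_def)

lemma integrable_RL_kernel:
  assumes "0 < \<beta>" "0 \<le> c"
  shows "integrable lborel (RL_kernel c \<beta>)"
proof -
  have "(\<lambda>s. s powr (\<beta> - 1)) absolutely_integrable_on {0..c}"
    using integrable_on_powr_from_0[of "\<beta> - 1" c] assms
    by (subst absolutely_integrable_on_iff_nonneg) auto
  then show ?thesis
    unfolding set_integrable_def RL_kernel_def
    by (subst (asm) integrable_completion) auto
qed

lemma borel_measurable_zero_ext:
  assumes "continuous_on {a..b} g"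
  shows "zero_ext a b g \<in> borel_measurable borel"
  unfolding zero_ext_def using assms by (intro borel_measurable_continuous_on_indicator) auto

lemma integrable_RL_kernel_times_zero_ext:
  assumes "0 < \<beta>" "a \<le> b" "continuous_on {a..b} g"
  shows "integrable lborel (\<lambda>s. RL_kernel (b - a) \<beta> s * zero_ext a b g (x - s))"
proof -
  obtain B where B: "\<And>t. t \<in> {a..b} \<Longrightarrow> \<bar>g t\<bar> \<le> B"
    using compact_imp_bounded[OF compact_continuous_image[OF assms(3) compact_Icc]]
    by (force simp: bounded_iff)
  \<comment> \<open>Outside the interval the extension is 0, and \<open>B\<close> is nonnegative
    because it bounds \<open>\<bar>g a\<bar>\<close>.\<close>
  have B': "\<bar>zero_ext a b g t\<bar> \<le> B" for t
    using B[of t] B[of a] assms by (auto simp: zero_ext_def indicator_def)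
  show ?thesis
  proof (rule Bochner_Integration.integrable_bound)
    show "integrable lborel (\<lambda>s. RL_kernel (b - a) \<beta> s * B)"
      using integrable_RL_kernel assms by simp
    show "AE s in lborel. norm (RL_kernel (b - a) \<beta> s * zero_ext a b g (x - s))
        \<le> norm (RL_kernel (b - a) \<beta> s * B)"
    proof (rule AE_I2)
      fix s
      show "norm (RL_kernel (b - a) \<beta> s * zero_ext a b g (x - s)) \<le> norm (RL_kernel (b - a) \<beta> s * B)"
        using B'[of "x - s"] by (simp add: abs_mult mult_left_mono)
    qed
    show "(\<lambda>s. RL_kernel (b - a) \<beta> s * zero_ext a b g (x - s)) \<in> borel_measurable lborel"
      using borel_measurable_integrable[OF integrable_RL_kernel] assms
      by (intro borel_measurable_times measurable_compose[OF _ borel_measurable_zero_ext]) simp_all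
  qed
qed

section \<open>Differentiating fractional integrals\<close>

text \<open>As \<open>g a = 0\<close>, the extension equals \<open>g\<close> after the clamping
  \<open>max a\<close> on \<open>{..b}\<close>, and clamping does not increase distances. Beyond
  \<open>b\<close> this fails, as the extension may jump there.\<close>

lemma zero_ext_lipschitz:
  assumes der: "\<And>t. t \<in> {a..b} \<Longrightarrow> (g has_field_derivative g' t) (at t within {a..b})"
    and B: "\<And>t. t \<in> {a..b} \<Longrightarrow> \<bar>g' t\<bar> \<le> B"
    and "g a = 0" "a \<le> b" "u \<le> b" "v \<le> b"
  shows "\<bar>zero_ext a b g u - zero_ext a b g v\<bar> \<le> B * \<bar>u - v\<bar>"
proof -
  have lip: "\<bar>g p - g q\<bar> \<le> B * \<bar>p - q\<bar>" if "p \<in> {a..b}" "q \<in> {a..b}" for p q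
    using field_differentiable_bound[of "{a..b}" g g' B p q] der B that by auto
  have clamp: "zero_ext a b g w = g (max a w)" if "w \<le> b" for w
    using that assms(3,4) by (auto simp: zero_ext_def indicator_def max_def)
  have "0 \<le> B"
    using B[of a] assms(4) by auto
  have "\<bar>g (max a u) - g (max a v)\<bar> \<le> B * \<bar>max a u - max a v\<bar>"
    using assms by (intro lip) auto
  also have "\<dots> \<le> B * \<bar>u - v\<bar>"
    using \<open>0 \<le> B\<close> by (intro mult_left_mono) auto
  finally show ?thesis
    using clamp assms by simp
qed

text \<open>To the left of \<open>a\<close> the extension is locally 0, to the right it is locally
  \<open>g\<close>; at \<open>a\<close> it may have a corner. Working within \<open>{..b}\<close>
  avoids the possible jump at \<open>b\<close>.\<close>

lemma zero_ext_has_field_derivative: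
  assumes der: "\<And>t. t \<in> {a..b} \<Longrightarrow> (g has_field_derivative g' t) (at t within {a..b})"
    and "t \<noteq> a" "t \<le> b"
  shows "(zero_ext a b g has_field_derivative zero_ext a b g' t) (at t within {..b})"
proof (cases "t < a")
  case True
  have "((\<lambda>_. 0) has_field_derivative 0) (at t within {..b})"
    by simp
  then have "(zero_ext a b g has_field_derivative 0) (at t within {..b})"
    by (rule has_field_derivative_transform_within[where d = "a - t"])
       (use True assms in \<open>auto simp: zero_ext_def indicator_def dist_real_def\<close>)
  then show ?thesis
    using True by (simp add: zero_ext_def)
next
  case False
  with assms have t: "t \<in> {a..b}" "a < t" by auto
  have "(g has_field_derivative g' t) (at t within {..b} \<inter> {a..})"
    using der[OF t(1)] by (simp add: Int_commute flip: atLeastAtMost_def)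
  moreover have "at t within {..b} \<inter> {a..} = at t within {..b}"
    by (rule at_within_nhd[where S = "{a<..}"]) (use t in auto)
  ultimately have "(g has_field_derivative g' t) (at t within {..b})"
    by simp
  then have "(zero_ext a b g has_field_derivative g' t) (at t within {..b})"
    by (rule has_field_derivative_transform_within[where d = "t - a"])
       (use t in \<open>auto simp: zero_ext_def indicator_def dist_real_def\<close>)
  then show ?thesis
    using t by (simp add: zero_ext_def)
qed

text \<open>Since \<open>g a = 0\<close>, the extension by zero is Lipschitz, so the difference quotients of the
  convolution are dominated by a multiple of the kernel; they converge except at \<open>s = x - a\<close>.\<close>

lemma RL_integral_has_field_derivative:
  assumes ab: "a < b" and "0 \<le> \<beta>" and x: "x \<in> {a..b}"
    and der: "\<And>t. t \<in> {a..b} \<Longrightarrow> (g has_field_derivative g' t) (at t within {a..b})"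
    and cont: "continuous_on {a..b} g'" and ga: "g a = 0"
  shows "(RL_integral a \<beta> g has_field_derivative RL_integral a \<beta> g' x) (at x within {a..b})"
proof (cases "\<beta> = 0")
  case True
  then show ?thesis
    using der[OF x] by (simp add: RL_integral_def[abs_def])
next
  case False
  with assms have \<beta>: "0 < \<beta>" by simp
  define K where "K = RL_kernel (b - a) \<beta>"
  define I where "I g x = (LINT s|lborel. K s * zero_ext a b g (x - s))" for g x
  have I: "RL_integral a \<beta> h y = 1 / Gamma \<beta> * I h y" if "y \<in> {a..b}" for h y
    using RL_integral_convolution[of \<beta> y a b h] False that by (simp add: I_def K_def)
  have cont_g: "continuous_on {a..b} g"
    by (rule DERIV_continuous_on[OF der])
  obtain B where B: "\<And>t. t \<in> {a..b} \<Longrightarrow> \<bar>g' t\<bar> \<le> B"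
    using compact_imp_bounded[OF compact_continuous_image[OF cont compact_Icc]]
    by (force simp: bounded_iff)
  \<comment> \<open>Only \<open>0 \<le> s\<close> contributes. Then \<open>x - s\<close> and
    \<open>X i - s\<close> stay in \<open>{..b}\<close>, where the extension is Lipschitz.\<close>
  have K_outside: "K s = 0" if "s < 0" for s
    using that by (simp add: K_def RL_kernel_def)
  have K_nonneg: "0 \<le> K s" for s
    by (simp add: K_def RL_kernel_nonneg)
  have int: "integrable lborel (\<lambda>s. K s * zero_ext a b h (y - s))" if "continuous_on {a..b} h" for h y
    using integrable_RL_kernel_times_zero_ext[OF \<beta> _ that] ab by (simp add: K_def)
  have "((\<lambda>y. (I g y - I g x) / (y - x)) \<longlongrightarrow> I g' x) (at x within {a..b})"
    \<comment> \<open>Dominated convergence concerns sequences, so the limit is tested along every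
      sequence in the interval that tends to \<open>x\<close> and avoids \<open>x\<close>.\<close>
    unfolding tendsto_at_iff_sequentially comp_def
  proof (intro allI impI)
    fix X :: "nat \<Rightarrow> real"
    assume X: "\<forall>i. X i \<in> {a..b} - {x}" and lim: "X \<longlonglongrightarrow> x"
    define Q where
      "Q i s = K s * ((zero_ext a b g (X i - s) - zero_ext a b g (x - s)) / (X i - x))" for i s
    have "Q i s = (K s * zero_ext a b g (X i - s) - K s * zero_ext a b g (x - s)) / (X i - x)" for i s
      by (simp add: Q_def algebra_simps diff_divide_distrib)
    then have "Q i = (\<lambda>s. (K s * zero_ext a b g (X i - s) - K s * zero_ext a b g (x - s)) / (X i - x))" for i
      by (rule ext)
    then have Q: "integrable lborel (Q i)" "integral\<^sup>L lborel (Q i) = (I g (X i) - I g x) / (X i - x)" for i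
      unfolding I_def using int[OF cont_g] by simp_all
    have "(\<lambda>i. integral\<^sup>L lborel (Q i)) \<longlonglongrightarrow> I g' x"
      unfolding I_def
    proof (rule integral_dominated_convergence[where w = "\<lambda>s. K s * B"])
      show "integrable lborel (\<lambda>s. K s * B)"
        using integrable_RL_kernel[OF \<beta>] ab by (simp add: K_def)
      \<comment> \<open>The excluded null set is the point with \<open>x - s = a\<close>, the
        possible corner of the extension.\<close>
      show "AE s in lborel. (\<lambda>i. Q i s) \<longlonglongrightarrow> K s * zero_ext a b g' (x - s)"
        using AE_lborel_singleton[of "x - a"]
      proof eventually_elim
        case (elim s)
        show ?case
        proof (cases "s < 0")
          case False
          have "((\<lambda>y. (zero_ext a b g y - zero_ext a b g (x - s)) / (y - (x - s)))
              \<longlongrightarrow> zero_ext a b g' (x - s)) (at (x - s) within {..b})"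
            using zero_ext_has_field_derivative[OF der, of "x - s"] elim False x
            unfolding has_field_derivative_iff by auto
          moreover have "filterlim (\<lambda>i. X i - s) (at (x - s) within {..b}) sequentially"
            unfolding filterlim_at using X False
            by (auto intro!: tendsto_intros lim always_eventually simp: algebra_simps add_increasing2)
          ultimately have "(\<lambda>i. (zero_ext a b g (X i - s) - zero_ext a b g (x - s)) / (X i - s - (x - s)))
              \<longlonglongrightarrow> zero_ext a b g' (x - s)"
            by (rule filterlim_compose)
          then show ?thesis
            unfolding Q_def by (intro tendsto_mult_left) simp
        qed (simp add: Q_def K_outside)
      qed
      show "AE s in lborel. norm (Q i s) \<le> K s * B" for i
      proof (rule AE_I2)
        fix s
        show "norm (Q i s) \<le> K s * B"
        proof (cases "s < 0")
          case False
          have "X i \<in> {a..b}" "X i \<noteq> x"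
            using X by auto
          then have "\<bar>zero_ext a b g (X i - s) - zero_ext a b g (x - s)\<bar> \<le> B * \<bar>(X i - s) - (x - s)\<bar>"
            using False x ab by (intro zero_ext_lipschitz[OF der B ga]) auto
          then have "\<bar>zero_ext a b g (X i - s) - zero_ext a b g (x - s)\<bar> / \<bar>X i - x\<bar> \<le> B"
            using \<open>X i \<noteq> x\<close> by (simp add: pos_divide_le_eq)
          then show ?thesis
            using mult_left_mono[OF _ K_nonneg[of s]] K_nonneg[of s]
            by (fastforce simp: Q_def abs_mult)
        qed (simp add: Q_def K_outside)
      qed
    qed (use Q int[OF cont] in \<open>auto intro: borel_measurable_integrable\<close>)
    then show "(\<lambda>i. (I g (X i) - I g x) / (X i - x)) \<longlonglongrightarrow> I g' x"
      by (simp add: Q)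
  qed
  then have "(I g has_field_derivative I g' x) (at x within {a..b})"
    by (simp add: has_field_derivative_iff)
  then have "((\<lambda>y. 1 / Gamma \<beta> * I g y) has_field_derivative 1 / Gamma \<beta> * I g' x) (at x within {a..b})"
    by (rule DERIV_cmult)
  then show ?thesis
    using x I
    by (auto simp: has_real_derivative_iff_has_vector_derivative intro: has_vector_derivative_transform)
qed

text \<open>Each derivative moved inside costs one zero at \<open>a\<close>: the step from
  \<open>l\<close> to \<open>Suc l\<close> uses \<open>nderiv a b l g a = 0\<close> and the
  continuity of the next derivative.\<close>

lemma nderiv_RL_integral:
  assumes "a < b" "0 \<le> \<beta>" "Cn a b l g" "\<And>k. k < l \<Longrightarrow> nderiv a b k g a = 0" "x \<in> {a..b}"
  shows "nderiv a b l (RL_integral a \<beta> g) x = RL_integral a \<beta> (nderiv a b l g) x"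
  using assms(3-5)
proof (induction l arbitrary: x)
  case (Suc l)
  have IH: "nderiv a b l (RL_integral a \<beta> g) y = RL_integral a \<beta> (nderiv a b l g) y"
    if "y \<in> {a..b}" for y
    using Suc.IH[OF Cn_mono[OF Suc.prems(1)]] Suc.prems(2) that by auto
  have "(RL_integral a \<beta> (nderiv a b l g) has_field_derivative
      RL_integral a \<beta> (nderiv a b (Suc l) g) x) (at x within {a..b})"
    using Suc.prems assms
    by (intro RL_integral_has_field_derivative nderiv_has_field_derivative)
       (auto simp: Cn_def ntimes_differentiable_def)
  then have "(nderiv a b l (RL_integral a \<beta> g) has_field_derivative
      RL_integral a \<beta> (nderiv a b (Suc l) g) x) (at x within {a..b})"
    using IH Suc.prems
    by (auto simp: has_real_derivative_iff_has_vector_derivative intro: has_vector_derivative_transform)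
  then show ?case
    using nderiv_Suc_eqI assms(1) Suc.prems(3) by blast
qed (simp add: nderiv_0)

section \<open>Caputo derivatives: integer order, then the composition rule\<close>

text \<open>For order \<open>l > 0\<close> the inner integral has order 0 and is the identity, and
  \<open>l\<close> derivatives annihilate the Taylor polynomial of degree
  \<open>l - 1\<close>.\<close>

lemma Cn_imp_caputo_deriv_eq_nderiv:
  assumes "a < b" "Cn a b l f"
  shows "continuously_caputo_differentiable a b (real l) f"
    and "x \<in> {a..b} \<Longrightarrow> caputo_deriv a b (real l) f x = nderiv a b l f x"
proof -
  have eq: "caputo_deriv a b (real l) f y = nderiv a b l f y" if "y \<in> {a..b}" for y
  proof (cases "l = 0")
    case False
    then have "caputo_deriv a b (real l) f y = nderiv a b l (\<lambda>t. f t - taylor_sum a b l f t) y"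
      by (simp add: caputo_deriv_def RL_deriv_def RL_integral_def[abs_def] taylor_poly_eq_taylor_sum)
    also have "\<dots> = nderiv a b l f y"
      using assms that by (subst nderiv_minus_taylor_sum) (auto simp: Cn_def taylor_sum_0)
    finally show ?thesis .
  qed (simp add: caputo_deriv_def nderiv_0)
  then show "x \<in> {a..b} \<Longrightarrow> caputo_deriv a b (real l) f x = nderiv a b l f x" .
  have "continuous_on {a..b} (caputo_deriv a b (real l) f)"
    using assms eq by (subst continuous_on_cong[OF refl]) (auto simp: Cn_def)
  moreover have "caputo_deriv_exists a b (real l) f"
  proof (cases "l = 0")
    case False
    then show ?thesis
      using ntimes_differentiable_minus_taylor_sum[of a b l f l] assms
      by (simp add: Cn_def caputo_deriv_exists_def RL_deriv_exists_def RL_integral_def[abs_def]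
          taylor_poly_eq_taylor_sum)
  qed (simp add: caputo_deriv_exists_def)
  ultimately show "continuously_caputo_differentiable a b (real l) f"
    using Cn_mono[OF assms(2), of "l - 1"]
    by (auto simp: continuously_caputo_differentiable_def caputo_deriv_def)
qed

theorem theorem10:
  fixes a b \<alpha> :: real and f :: "real \<Rightarrow> real" and l :: nat
  assumes "a < b"
    and "\<alpha> > 0"
    and "Cn a b (nat \<lceil>\<alpha>\<rceil> - 1) f"
    and "continuously_caputo_differentiable a b \<alpha> f"
    and "int l \<le> \<lceil>\<alpha>\<rceil> - 1"
  shows "continuously_caputo_differentiable a b (real l) f \<and>
    (\<forall>x\<in>{a..b}. caputo_deriv a b (real l) f x = nderiv a b l f x) \<and>
    Cn a b l f \<and>
    continuously_caputo_differentiable a b (\<alpha> - real l) (nderiv a b l f) \<and>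
    (\<forall>x\<in>{a..b}. caputo_deriv a b (\<alpha> - real l) (nderiv a b l f) x = caputo_deriv a b \<alpha> f x)"
proof -
  define m where "m = nat \<lceil>\<alpha>\<rceil>"
  define \<beta> where "\<beta> = real m - \<alpha>"
  define g where "g = (\<lambda>t. f t - taylor_sum a b m f t)"
  define h where "h = (\<lambda>t. nderiv a b l f t - taylor_sum a b (m - l) (nderiv a b l f) t)"
  have lm: "l < m"
    using assms(2,5) unfolding m_def by linarith
  have "0 < \<alpha> - real l"
    using assms(5) by linarith
  have "0 \<le> \<beta>"
    unfolding \<beta>_def m_def by linarith
  \<comment> \<open>An integer shift passes through the ceiling, so the outer order drops by
    \<open>l\<close> while the order \<beta> of the inner integral is unchanged.\<close>
  have order: "nat \<lceil>\<alpha> - real l\<rceil> = m - l" "real (m - l) - (\<alpha> - real l) = \<beta>"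
    using lm by (auto simp: m_def \<beta>_def of_nat_diff nat_diff_distrib' ceiling_diff_of_int[of \<alpha> "int l", simplified])
  have Cm: "Cn a b (m - 1) f"
    using assms(3) by (simp add: m_def)
  have Cl: "Cn a b l f"
    using Cn_mono[OF Cm] lm by simp
  have h: "nderiv a b l g x = h x" if "x \<in> {a..b}" for x
    unfolding g_def h_def using Cl lm assms(1) that by (intro nderiv_minus_taylor_sum) (auto simp: Cn_def)
  \<comment> \<open>At \<open>a\<close> only the constant term of the remaining
    \<open>m - k > 0\<close> Taylor terms survives, and it cancels the derivative of
    \<open>f\<close>.\<close>
  have zero: "nderiv a b k g a = 0" if "k < l" for k
    unfolding g_def using Cl lm assms(1) that
    by (subst nderiv_minus_taylor_sum) (auto simp: Cn_def ntimes_differentiable_def taylor_sum_at_base)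
  have Cg: "Cn a b l g"
    unfolding g_def using Cn_minus_taylor_sum assms(1) Cl lm by simp
  have RL: "nderiv a b l (RL_integral a \<beta> g) x = RL_integral a \<beta> h x" if "x \<in> {a..b}" for x
    using nderiv_RL_integral[OF assms(1) \<open>0 \<le> \<beta>\<close> Cg zero that] RL_integral_cong[OF h that] by simp
  have caputo: "caputo_deriv a b \<alpha> f = nderiv a b m (RL_integral a \<beta> g)"
    "caputo_deriv_exists a b \<alpha> f \<longleftrightarrow> ntimes_differentiable a b m (RL_integral a \<beta> g)"
    using assms(2) lm
    by (simp_all add: caputo_deriv_def caputo_deriv_exists_def RL_deriv_def RL_deriv_exists_def
        taylor_poly_eq_taylor_sum g_def \<beta>_def flip: m_def)
  have caputo_l: "caputo_deriv a b (\<alpha> - real l) (nderiv a b l f) = nderiv a b (m - l) (RL_integral a \<beta> h)"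
    "caputo_deriv_exists a b (\<alpha> - real l) (nderiv a b l f)
      \<longleftrightarrow> ntimes_differentiable a b (m - l) (RL_integral a \<beta> h)"
    using \<open>0 < \<alpha> - real l\<close> lm taylor_poly_eq_taylor_sum[of "m - l"] order
    by (simp_all add: caputo_deriv_def caputo_deriv_exists_def RL_deriv_def RL_deriv_exists_def h_def Let_def)
  \<comment> \<open>The \<open>m\<close> outer derivatives split into \<open>l\<close> inner ones,
    which turn the integral of \<open>g\<close> into that of \<open>h\<close>, followed by
    \<open>m - l\<close> more.\<close>
  have eq: "caputo_deriv a b (\<alpha> - real l) (nderiv a b l f) x = caputo_deriv a b \<alpha> f x"
    if "x \<in> {a..b}" for x
    using nderiv_cong[where n = "m - l", OF RL that] nderiv_add[of a b "m - l" l] lm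
    by (simp add: caputo caputo_l)
  have "caputo_deriv_exists a b \<alpha> f" "continuous_on {a..b} (caputo_deriv a b \<alpha> f)"
    using assms(2,4) by (auto simp: continuously_caputo_differentiable_def)
  moreover have "ntimes_differentiable a b (m - l) (nderiv a b l (RL_integral a \<beta> g))
      \<longleftrightarrow> ntimes_differentiable a b (m - l) (RL_integral a \<beta> h)"
    by (rule ntimes_differentiable_cong[OF RL])
  moreover have "continuous_on {a..b} (caputo_deriv a b (\<alpha> - real l) (nderiv a b l f))
      \<longleftrightarrow> continuous_on {a..b} (caputo_deriv a b \<alpha> f)"
    by (rule continuous_on_cong[OF refl eq])
  \<comment> \<open>Existence transfers because \<open>m\<close>-fold differentiability of the
    integral of \<open>g\<close> contains \<open>(m - l)\<close>-fold differentiability of its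
    \<open>l\<close>-th derivative.\<close>
  ultimately have "caputo_deriv_exists a b (\<alpha> - real l) (nderiv a b l f)"
    "continuous_on {a..b} (caputo_deriv a b (\<alpha> - real l) (nderiv a b l f))"
    using ntimes_differentiable_nderiv[of a b "m - l" l] lm by (auto simp: caputo(2) caputo_l(2))
  moreover have "Cn a b (m - l - 1) (nderiv a b l f)"
    using Cn_nderiv[of a b "m - l - 1" l f] Cm lm by simp
  ultimately have "continuously_caputo_differentiable a b (\<alpha> - real l) (nderiv a b l f)"
    using \<open>0 < \<alpha> - real l\<close> order by (simp add: continuously_caputo_differentiable_def)
  then show ?thesis
    using Cn_imp_caputo_deriv_eq_nderiv[OF assms(1) Cl] Cl eq by blast
qed

end
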